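(* Let $r$ be a positive integer. For any graph $G$ with $\chi(G)\geq r$, \[t(G)+\frac12 e(G)\geq\binom r3+\frac12 \binom r2,\] where $e(G)$ is the number of edges and $t(G)$ is the number of triangles of $G$.
   Context: All graphs are finite and simple. *)

theory Defs
  imports Complex_Main "Graph_Theory.Pair_Digraph"
begin

text \<open>
  The locale \<open>pair_graph\<close> describes finite simple graphs as finite, loop-free, symmetric sets of
  ordered pairs; every undirected edge is present as two arcs. Edges are therefore counted
  as unordered pairs, not as arcs.
\<close>

definition edge_set :: "'a pair_pre_digraph \<Rightarrow> 'a set set" where
  "edge_set G = {{u, v} | u v. (u, v) \<in> parcs G}"

definition num_edges :: "'a pair_pre_digraph \<Rightarrow> nat" where
  "num_edges G = card (edge_set G)"

definition triangle_set :: "'a pair_pre_digraph \<Rightarrow> 'a set set" where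
  "triangle_set G =
     {T. T \<subseteq> pverts G \<and> card T = 3 \<and> (\<forall>u\<in>T. \<forall>v\<in>T. u \<noteq> v \<longrightarrow> (u, v) \<in> parcs G)}"

definition num_triangles :: "'a pair_pre_digraph \<Rightarrow> nat" where
  "num_triangles G = card (triangle_set G)"

definition proper_colouring :: "'a pair_pre_digraph \<Rightarrow> nat \<Rightarrow> ('a \<Rightarrow> nat) \<Rightarrow> bool" where
  "proper_colouring G k c \<longleftrightarrow>
     c ` pverts G \<subseteq> {..<k} \<and> (\<forall>(u, v) \<in> parcs G. c u \<noteq> c v)"

definition chromatic_number :: "'a pair_pre_digraph \<Rightarrow> nat" where
  "chromatic_number G = (LEAST k. \<exists>c. proper_colouring G k c)"

text \<open>The least number of colours is attained, so \<open>LEAST\<close> above is not underspecified.\<close>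

lemma (in pair_graph) ex_proper_colouring_chromatic_number:
  "\<exists>c. proper_colouring G (chromatic_number G) c"
proof -
  obtain f :: "'a \<Rightarrow> nat" where f: "bij_betw f (pverts G) {0..<card (pverts G)}"
    using ex_bij_betw_finite_nat[OF pair_finite_verts] by blast
  have "proper_colouring G (card (pverts G)) f"
    unfolding proper_colouring_def
  proof (intro conjI ballI, goal_cases)
    case 1
    show ?case using f by (auto simp: bij_betw_def)
  next
    case (2 e)
    obtain u v where e: "e = (u, v)" by (cases e)
    have "u \<noteq> v" "u \<in> pverts G" "v \<in> pverts G"
      using 2 pair_no_loops[of e] in_arcsD1[of u v] in_arcsD2[of u v] e by simp_all
    then have "f u \<noteq> f v"
      using f by (meson bij_betw_def inj_onD)
    then show ?case by (simp add: e)
  qed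
  then have "\<exists>k c. proper_colouring G k c" by blast
  then show ?thesis
    unfolding chromatic_number_def by (rule LeastI_ex)
qed

end

(* Pass to a vertex set minimal among those with chromatic number at least r, so that all degrees
   are at least r - 1. Removing an independent set I lowers the chromatic number by at most one and
   lowers t + e/2 by half the sum over v in I of f v = d v + 2 e(N v), while the right-hand side
   drops by (r - 1)^2 / 2 from r to r - 1. If v minimises f, then Turan's bound, applied to the
   neighbourhood of v, gives an independent set I contained in N v with
   |I| >= (d v)^2 / (d v + 2 e(N v)) = (d v)^2 / f v, so that the sum of f over I is at least
   |I| f v >= (d v)^2 >= (r - 1)^2. *)
theory Submission
  imports Defs "HOL-Analysis.Convex"
begin

text \<open>Cauchy-Schwarz for \<open>sqrt (1 / g x)\<close> and \<open>sqrt (g x)\<close>, whose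
  products are all 1. It later turns the Caro-Wei sum into a bound by the degree sum.\<close>

lemma Cauchy_Schwarz_inverse_sum:
  fixes g :: "'a \<Rightarrow> real"
  assumes "\<And>x. x \<in> A \<Longrightarrow> g x > 0"
  shows "(real (card A))\<^sup>2 \<le> (\<Sum>x\<in>A. 1 / g x) * (\<Sum>x\<in>A. g x)"
proof -
  have "(\<Sum>x\<in>A. sqrt (1 / g x) * sqrt (g x))\<^sup>2
      \<le> (\<Sum>x\<in>A. (sqrt (1 / g x))\<^sup>2) * (\<Sum>x\<in>A. (sqrt (g x))\<^sup>2)"
    by (rule Cauchy_Schwarz_ineq_sum)
  moreover have "(\<Sum>x\<in>A. sqrt (1 / g x) * sqrt (g x)) = (\<Sum>x\<in>A. 1)"
    using assms by (intro sum.cong refl) (simp add: real_sqrt_divide less_imp_neq[symmetric])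
  moreover have "(\<Sum>x\<in>A. (sqrt (1 / g x))\<^sup>2) = (\<Sum>x\<in>A. 1 / g x)"
    using assms by (intro sum.cong refl) (simp add: less_imp_le)
  moreover have "(\<Sum>x\<in>A. (sqrt (g x))\<^sup>2) = (\<Sum>x\<in>A. g x)"
    using assms by (intro sum.cong refl) (simp add: less_imp_le)
  ultimately show ?thesis by simp
qed

text \<open>One adjacency relation is fixed and only the vertex set varies, so induced subgraphs are
  plain sets and deleting vertices is set difference.\<close>

locale sym_irrefl =
  fixes E :: "'a \<Rightarrow> 'a \<Rightarrow> bool"
  assumes sym: "E u v \<Longrightarrow> E v u"
    and irrefl: "\<not> E v v"
begin

definition nbrs :: "'a set \<Rightarrow> 'a \<Rightarrow> 'a set" where
  "nbrs V v = {u \<in> V. E v u}"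

text \<open>Keeping the size as a parameter lets a single recursion serve for both edges and
  triangles.\<close>

definition cliques :: "nat \<Rightarrow> 'a set \<Rightarrow> 'a set set" where
  "cliques k V = {S. S \<subseteq> V \<and> card S = k \<and> (\<forall>u\<in>S. \<forall>v\<in>S. u \<noteq> v \<longrightarrow> E u v)}"

definition independent :: "'a set \<Rightarrow> bool" where
  "independent I \<longleftrightarrow> (\<forall>u\<in>I. \<forall>v\<in>I. \<not> E u v)"

definition colourable :: "nat \<Rightarrow> 'a set \<Rightarrow> bool" where
  "colourable k V \<longleftrightarrow>
     (\<exists>c :: 'a \<Rightarrow> nat. c ` V \<subseteq> {..<k} \<and> (\<forall>u\<in>V. \<forall>v\<in>V. E u v \<longrightarrow> c u \<noteq> c v))"

definition weight :: "'a set \<Rightarrow> real" where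
  "weight V = real (card (cliques 3 V)) + 1 / 2 * real (card (cliques 2 V))"

text \<open>Twice the weight that \<open>v\<close> contributes: each neighbour gives an edge,
  counted one half, and each edge among the neighbours gives a triangle.\<close>

definition local_weight :: "'a set \<Rightarrow> 'a \<Rightarrow> real" where
  "local_weight V v = real (card (nbrs V v)) + 2 * real (card (cliques 2 (nbrs V v)))"

section \<open>Cliques and weight when vertices are added or removed\<close>

lemma finite_nbrs [simp]: "finite V \<Longrightarrow> finite (nbrs V v)"
  by (simp add: nbrs_def)

lemma finite_cliques [simp]: "finite V \<Longrightarrow> finite (cliques k V)"
  by (rule finite_subset[of _ "Pow V"]) (auto simp: cliques_def)

lemma cliques_mono: "U \<subseteq> V \<Longrightarrow> cliques k U \<subseteq> cliques k V"
  by (auto simp: cliques_def)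

lemma card_cliques_1: "card (cliques 1 V) = card V"
proof -
  have "cliques 1 V = (\<lambda>v. {v}) ` V"
    by (auto simp: cliques_def card_1_singleton_iff)
  then show ?thesis by (simp add: card_image)
qed

text \<open>Cliques avoiding \<open>v\<close> stay in \<open>V\<close>; those containing
  \<open>v\<close> become, on deleting \<open>v\<close>, the cliques one smaller among its
  neighbours.\<close>

lemma card_cliques_insert:
  assumes "finite V" "v \<notin> V"
  shows "card (cliques (Suc k) (insert v V)) = card (cliques (Suc k) V) + card (cliques k (nbrs V v))"
proof -
  have "cliques (Suc k) (insert v V) = cliques (Suc k) V \<union> insert v ` cliques k (nbrs V v)"
  proof (intro equalityI subsetI)
    fix S assume S: "S \<in> cliques (Suc k) (insert v V)"
    show "S \<in> cliques (Suc k) V \<union> insert v ` cliques k (nbrs V v)"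
    proof (cases "v \<in> S")
      case True
      have "S - {v} \<in> cliques k (nbrs V v)"
        using S True by (auto simp: cliques_def nbrs_def)
      moreover have "S = insert v (S - {v})" using True by blast
      ultimately show ?thesis by blast
    next
      case False
      then show ?thesis using S by (auto simp: cliques_def)
    qed
  next
    fix S assume "S \<in> cliques (Suc k) V \<union> insert v ` cliques k (nbrs V v)"
    then show "S \<in> cliques (Suc k) (insert v V)"
    proof
      assume "S \<in> cliques (Suc k) V"
      then show ?thesis by (auto simp: cliques_def)
    next
      assume "S \<in> insert v ` cliques k (nbrs V v)"
      then obtain R where R: "S = insert v R" "R \<in> cliques k (nbrs V v)" by blast
      then have "R \<subseteq> V" by (auto simp: cliques_def nbrs_def)
      then have "finite R" "v \<notin> R" using assms finite_subset by auto
      then show ?thesis using R by (auto simp: cliques_def nbrs_def intro: sym)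
    qed
  qed
  moreover have "cliques (Suc k) V \<inter> insert v ` cliques k (nbrs V v) = {}"
    using assms by (auto simp: cliques_def)
  moreover have "inj_on (insert v) (cliques k (nbrs V v))"
    using assms by (intro inj_onI) (auto simp: cliques_def nbrs_def insert_ident)
  ultimately show ?thesis
    using assms by (simp add: card_Un_disjoint card_image)
qed

lemma weight_insert:
  assumes "finite V" "v \<notin> V"
  shows "weight (insert v V) = weight V + 1 / 2 * local_weight V v"
  using card_cliques_insert[OF assms, of 2] card_cliques_insert[OF assms, of 1]
    card_cliques_1[of "nbrs V v"]
  by (simp add: weight_def local_weight_def numeral_eq_Suc add_divide_distrib)

lemma weight_mono: "finite V \<Longrightarrow> U \<subseteq> V \<Longrightarrow> weight U \<le> weight V"
  using card_mono[OF _ cliques_mono] by (simp add: weight_def add_mono)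

text \<open>The vertices of \<open>I\<close> are added one at a time; by independence, those already
  added do not enter the neighbourhood of the next one.\<close>

lemma weight_Un_independent:
  assumes "finite I" "finite V" "V \<inter> I = {}" "independent I"
  shows "weight (V \<union> I) = weight V + 1 / 2 * (\<Sum>v\<in>I. local_weight V v)"
  using assms
proof (induction I rule: finite_induct)
  case (insert x I)
  then have "nbrs (V \<union> I) x = nbrs V x"
    by (auto simp: nbrs_def independent_def)
  then have "local_weight (V \<union> I) x = local_weight V x"
    by (simp add: local_weight_def)
  moreover have "weight (insert x (V \<union> I)) = weight (V \<union> I) + 1 / 2 * local_weight (V \<union> I) x"
    using insert by (intro weight_insert) auto
  ultimately show ?case
    using insert by (auto simp: independent_def)
qed simp

lemma weight_Diff_independent:
  assumes "finite V" "I \<subseteq> V" "independent I"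
  shows "weight V = weight (V - I) + 1 / 2 * (\<Sum>v\<in>I. local_weight V v)"
proof -
  have "local_weight (V - I) v = local_weight V v" if "v \<in> I" for v
  proof -
    have "nbrs (V - I) v = nbrs V v"
      using assms that by (auto simp: nbrs_def independent_def)
    then show ?thesis by (simp add: local_weight_def)
  qed
  moreover have "weight (V - I \<union> I) = weight (V - I) + 1 / 2 * (\<Sum>v\<in>I. local_weight (V - I) v)"
    using assms finite_subset by (intro weight_Un_independent) auto
  moreover have "V - I \<union> I = V" using assms by blast
  ultimately show ?thesis by simp
qed

section \<open>Large independent sets\<close>

lemma handshake:
  "finite V \<Longrightarrow> (\<Sum>v\<in>V. card (nbrs V v)) = 2 * card (cliques 2 V)"
proof (induction V rule: finite_induct)
  case empty
  have "cliques 2 {} = {}" by (auto simp: cliques_def)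
  then show ?case by simp
next
  case (insert x V)
  have "card (nbrs (insert x V) v) = card (nbrs V v) + (if E x v then 1 else 0)" if "v \<in> V" for v
  proof -
    have "nbrs (insert x V) v = (if E x v then insert x (nbrs V v) else nbrs V v)"
      by (auto simp: nbrs_def intro: sym)
    moreover have "x \<notin> nbrs V v" using insert by (simp add: nbrs_def)
    ultimately show ?thesis using insert by simp
  qed
  then have "(\<Sum>v\<in>V. card (nbrs (insert x V) v))
      = (\<Sum>v\<in>V. card (nbrs V v)) + (\<Sum>v\<in>V. if E x v then 1 else 0)"
    by (simp add: sum.distrib)
  moreover have "(\<Sum>v\<in>V. if E x v then 1 else 0) = card (nbrs V x)"
    using insert by (simp add: nbrs_def Int_def flip: sum.inter_filter)
  moreover have "nbrs (insert x V) x = nbrs V x"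
    by (auto simp: nbrs_def irrefl)
  ultimately show ?case
    using insert card_cliques_insert[of V x 1] card_cliques_1[of "nbrs V x"]
    by (simp add: numeral_2_eq_2)
qed

text \<open>Greedy choice: take a vertex \<open>u\<close> of minimum degree, delete its closed
  neighbourhood and recurse. The deleted terms sum to at most 1, which \<open>u\<close> pays
  for.\<close>

lemma Caro_Wei:
  assumes "finite V"
  shows "\<exists>I\<subseteq>V. independent I \<and> (\<Sum>v\<in>V. 1 / (real (card (nbrs V v)) + 1)) \<le> real (card I)"
  using assms
proof (induction V rule: finite_psubset_induct)
  case (psubset V)
  show ?case
  proof (cases "V = {}")
    case True
    then show ?thesis by (auto simp: independent_def)
  next
    case False
    obtain u where u: "u \<in> V" "\<And>v. v \<in> V \<Longrightarrow> card (nbrs V u) \<le> card (nbrs V v)"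
      using ex_min_if_finite[of "(\<lambda>v. card (nbrs V v)) ` V"] False psubset.hyps
      by (metis (no_types, lifting) arg_min_if_finite(1) arg_min_least)
    define U where "U = insert u (nbrs V u)"
    define W where "W = V - U"
    let ?g = "\<lambda>V v. 1 / (real (card (nbrs V v)) + 1)"
    have U: "U \<subseteq> V" "finite U" "card U = card (nbrs V u) + 1"
      using u psubset.hyps by (auto simp: U_def nbrs_def irrefl)
    have W: "W \<subset> V" "finite W" using u psubset.hyps by (auto simp: W_def U_def)
    then obtain J where J: "J \<subseteq> W" "independent J" "(\<Sum>v\<in>W. ?g W v) \<le> real (card J)"
      using psubset.IH by blast
    have "finite J" "u \<notin> J" using J W finite_subset by (auto simp: W_def U_def)
    have "independent (insert u J)"
      using J by (auto simp: independent_def W_def U_def nbrs_def irrefl dest: sym)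
    moreover have "insert u J \<subseteq> V" using J W u by auto
    moreover have "(\<Sum>v\<in>V. ?g V v) \<le> real (card (insert u J))"
    proof -
      \<comment> \<open>By minimality of the degree of \<open>u\<close>, no term exceeds that of
        \<open>u\<close>, and \<open>card U\<close> is exactly the denominator of that term.\<close>
      have "(\<Sum>v\<in>U. ?g V v) \<le> (\<Sum>v\<in>U. ?g V u)"
        using u U by (intro sum_mono divide_left_mono) (auto intro!: mult_pos_pos)
      also have "\<dots> = 1" using U by simp
      finally have "(\<Sum>v\<in>U. ?g V v) \<le> 1" .
      \<comment> \<open>Passing to \<open>W\<close> can only lower degrees, so the remaining terms
        can only grow.\<close>
      moreover have "(\<Sum>v\<in>W. ?g V v) \<le> (\<Sum>v\<in>W. ?g W v)"
      proof (intro sum_mono divide_left_mono)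
        fix v
        have "nbrs W v \<subseteq> nbrs V v" using W by (auto simp: nbrs_def)
        then show "real (card (nbrs W v)) + 1 \<le> real (card (nbrs V v)) + 1"
          using psubset.hyps by (simp add: card_mono)
      qed (auto intro!: mult_pos_pos)
      moreover have "(\<Sum>v\<in>V. ?g V v) = (\<Sum>v\<in>W. ?g V v) + (\<Sum>v\<in>U. ?g V v)"
        unfolding W_def using U psubset.hyps by (intro sum.subset_diff) auto
      ultimately show ?thesis using J \<open>finite J\<close> \<open>u \<notin> J\<close> by simp
    qed
    ultimately show ?thesis by blast
  qed
qed

text \<open>Caro-Wei followed by Cauchy-Schwarz with \<open>g\<close> the degree plus one, whose sum
  the handshake lemma evaluates. The product form avoids a quotient that would be 0/0 for empty
  \<open>V\<close>.\<close>

lemma Turan_independent: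
  assumes "finite V"
  shows "\<exists>I\<subseteq>V. independent I \<and>
    (real (card V))\<^sup>2 \<le> real (card I) * (real (card V) + 2 * real (card (cliques 2 V)))"
proof -
  let ?d = "\<lambda>v. real (card (nbrs V v)) + 1"
  obtain I where I: "I \<subseteq> V" "independent I" "(\<Sum>v\<in>V. 1 / ?d v) \<le> real (card I)"
    using Caro_Wei[OF assms] by blast
  have "(real (card V))\<^sup>2 \<le> (\<Sum>v\<in>V. 1 / ?d v) * (\<Sum>v\<in>V. ?d v)"
    by (rule Cauchy_Schwarz_inverse_sum) simp
  also have "\<dots> \<le> real (card I) * (\<Sum>v\<in>V. ?d v)"
    by (rule mult_right_mono[OF I(3)]) (simp add: sum_nonneg)
  also have "(\<Sum>v\<in>V. ?d v) = real (card V) + 2 * real (card (cliques 2 V))"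
    using arg_cong[OF handshake[OF assms], of real] by (simp add: sum.distrib)
  finally show ?thesis using I by blast
qed

section \<open>Extending colourings\<close>

lemma colourable_Diff_independent:
  assumes "colourable k (V - I)" "independent I"
  shows "colourable (Suc k) V"
proof -
  obtain c :: "'a \<Rightarrow> nat" where c: "c ` (V - I) \<subseteq> {..<k}"
      "\<And>u v. u \<in> V - I \<Longrightarrow> v \<in> V - I \<Longrightarrow> E u v \<Longrightarrow> c u \<noteq> c v"
    using assms unfolding colourable_def by blast
  have lt: "c v < k" if "v \<in> V" "v \<notin> I" for v using c that by auto
  \<comment> \<open>The new colour \<open>k\<close> is reserved for \<open>I\<close>.\<close>
  let ?c = "\<lambda>v. if v \<in> I then k else c v"
  have "?c ` V \<subseteq> {..<Suc k}" using lt by (auto simp: less_Suc_eq)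
  moreover have "?c u \<noteq> ?c v" if "u \<in> V" "v \<in> V" "E u v" for u v
    using that c(2)[of u v] lt[of u] lt[of v] assms(2) by (auto simp: independent_def)
  ultimately show ?thesis unfolding colourable_def by blast
qed

text \<open>Fewer than \<open>k\<close> colours occur on the neighbours, so one is free for
  \<open>v\<close>. This yields the degree bound in critical sets.\<close>

lemma colourable_insert_low_degree:
  assumes "colourable k V" "finite V" "card (nbrs V v) < k" "v \<notin> V"
  shows "colourable k (insert v V)"
proof -
  obtain c :: "'a \<Rightarrow> nat" where c: "c ` V \<subseteq> {..<k}"
      "\<And>u v. u \<in> V \<Longrightarrow> v \<in> V \<Longrightarrow> E u v \<Longrightarrow> c u \<noteq> c v"
    using assms unfolding colourable_def by blast
  have "card (c ` nbrs V v) < card {..<k}"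
    using card_image_le[of "nbrs V v" c] assms by simp
  then have "\<not> {..<k} \<subseteq> c ` nbrs V v"
    using assms by (metis card_mono finite_imageI finite_nbrs not_less)
  then obtain i where i: "i < k" "i \<notin> c ` nbrs V v" by blast
  have i': "c u \<noteq> i" if "u \<in> V" "E v u \<or> E u v" for u
    using i that by (auto simp: nbrs_def intro: sym)
  let ?c = "c(v := i)"
  have "?c ` insert v V \<subseteq> {..<k}" using c(1) i assms by auto
  moreover have "?c x \<noteq> ?c y" if "x \<in> insert v V" "y \<in> insert v V" "E x y" for x y
    using that c(2)[of x y] i'[of x] i'[of y] irrefl[of v] by auto
  ultimately show ?thesis unfolding colourable_def by blast
qed

text \<open>Here \<open>m\<close> plays the role of r - 1. In the form of a sum of squares, the
  bound grows in each induction step by exactly the half square that deleting an independent set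
  releases.\<close>

lemma weight_ge_of_not_colourable:
  assumes "finite V" "\<not> colourable m V"
  shows "1 / 2 * (\<Sum>i\<le>m. (real i)\<^sup>2) \<le> weight V"
  using assms
proof (induction m arbitrary: V)
  case 0
  then show ?case by (simp add: weight_def)
next
  case (Suc m)
  have "\<exists>U \<subseteq> V. \<not> colourable (Suc m) U \<and> (\<forall>W. W \<subset> U \<longrightarrow> colourable (Suc m) W)"
    using Suc.prems
  proof (induction V rule: finite_psubset_induct)
    case (psubset V)
    show ?case
    proof (cases "\<forall>W. W \<subset> V \<longrightarrow> colourable (Suc m) W")
      case True
      then show ?thesis using psubset.prems by blast
    next
      case False
      then show ?thesis using psubset.IH by (meson psubset_imp_subset subset_trans)
    qed
  qed
  then obtain U where U: "U \<subseteq> V" "\<not> colourable (Suc m) U"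
      and crit: "\<And>W. W \<subset> U \<Longrightarrow> colourable (Suc m) W"
    by blast
  have fin: "finite U" using U Suc.prems finite_subset by blast
  \<comment> \<open>By criticality \<open>U - {v}\<close> is colourable, and a vertex of smaller
    degree could be added back.\<close>
  have deg: "Suc m \<le> card (nbrs U v)" if "v \<in> U" for v
  proof (rule ccontr)
    have "nbrs (U - {v}) v = nbrs U v" by (auto simp: nbrs_def irrefl)
    moreover assume "\<not> Suc m \<le> card (nbrs U v)"
    ultimately have "colourable (Suc m) (insert v (U - {v}))"
      using fin crit[of "U - {v}"] that by (intro colourable_insert_low_degree) auto
    then show False using U that by (simp add: insert_absorb)
  qed
  have "U \<noteq> {}" using U by (auto simp: colourable_def)
  then obtain v where v: "v \<in> U" "\<And>u. u \<in> U \<Longrightarrow> local_weight U v \<le> local_weight U u"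
    using fin by (metis arg_min_if_finite(1) arg_min_least)
  \<comment> \<open>The second factor in Turan's bound for the neighbourhood of \<open>v\<close> is
    precisely \<open>local_weight U v\<close>.\<close>
  obtain I where I: "I \<subseteq> nbrs U v" "independent I"
      "(real (card (nbrs U v)))\<^sup>2 \<le> real (card I) * local_weight U v"
    using Turan_independent[of "nbrs U v"] fin by (auto simp: local_weight_def)
  have "I \<subseteq> U" using I by (auto simp: nbrs_def)
  have "\<not> colourable m (U - I)"
    using U I colourable_Diff_independent by blast
  then have IH: "1 / 2 * (\<Sum>i\<le>m. (real i)\<^sup>2) \<le> weight (U - I)"
    using Suc.IH fin by blast
  have "(real (Suc m))\<^sup>2 \<le> (real (card (nbrs U v)))\<^sup>2"
    using deg[OF v(1)] by (intro power_mono) auto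
  also have "\<dots> \<le> real (card I) * local_weight U v" by (rule I)
  \<comment> \<open>This is where the minimality of \<open>local_weight U v\<close> is used.\<close>
  also have "\<dots> \<le> (\<Sum>u\<in>I. local_weight U u)"
    using v(2) \<open>I \<subseteq> U\<close> by (intro sum_bounded_below) auto
  finally have "1 / 2 * (\<Sum>i\<le>Suc m. (real i)\<^sup>2) \<le> weight U"
    using IH weight_Diff_independent[OF fin \<open>I \<subseteq> U\<close> I(2)] by simp
  also have "\<dots> \<le> weight V" using Suc.prems U by (intro weight_mono)
  finally show ?case .
qed

end

section \<open>Binomial form of the bound and transfer to graphs\<close>

lemma sum_squares_eq_binomial:
  "1 / 2 * (\<Sum>i\<le>m. (real i)\<^sup>2) = real (Suc m choose 3) + 1 / 2 * real (Suc m choose 2)"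
proof (induction m)
  case (Suc m)
  \<comment> \<open>By Pascal's rule the right-hand side grows by \<open>Suc m choose 2\<close> plus
    half of \<open>Suc m\<close>, which is half the square of \<open>Suc m\<close>.\<close>
  have "real (Suc m choose 2) = real (Suc m) * real m / 2"
    by (simp add: choose_two real_of_nat_div field_simps)
  then show ?case
    using Suc by (simp add: numeral_eq_Suc field_simps power2_eq_square)
qed (simp add: numeral_eq_Suc)

theorem theorem2p2:
  fixes r :: nat and G :: "'a pair_pre_digraph"
  assumes "r \<ge> 1"
    and "pair_graph G"
    and "chromatic_number G \<ge> r"
  shows "real (num_triangles G) + 1 / 2 * real (num_edges G)
           \<ge> real (r choose 3) + 1 / 2 * real (r choose 2)"
proof -
  interpret pair_graph G by fact
  let ?E = "\<lambda>u v. (u, v) \<in> parcs G"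
  interpret g: sym_irrefl ?E
    by unfold_locales (simp add: arcs_symmetric, use pair_no_loops in fastforce)
  obtain m where m: "r = Suc m" using assms(1) by (cases r) auto
  have wf: "u \<in> pverts G" "v \<in> pverts G" if "(u, v) \<in> parcs G" for u v
    using that in_arcsD1 in_arcsD2 by auto
  have "triangle_set G = g.cliques 3 (pverts G)"
    by (simp add: triangle_set_def g.cliques_def)
  \<comment> \<open>\<open>edge_set\<close> mentions only arcs; that their ends are vertices comes
    from \<open>wf\<close>, and that they are distinct from \<open>g.irrefl\<close>.\<close>
  moreover have "edge_set G = g.cliques 2 (pverts G)"
  proof (intro equalityI subsetI)
    fix e assume "e \<in> edge_set G"
    then obtain u v where "e = {u, v}" "(u, v) \<in> parcs G" by (auto simp: edge_set_def)
    then show "e \<in> g.cliques 2 (pverts G)"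
      using wf g.sym g.irrefl by (auto simp: g.cliques_def card_insert_if)
  next
    fix e assume "e \<in> g.cliques 2 (pverts G)"
    then obtain u v where "e = {u, v}" "(u, v) \<in> parcs G"
      unfolding g.cliques_def card_2_iff by blast
    then show "e \<in> edge_set G" unfolding edge_set_def by blast
  qed
  ultimately have "g.weight (pverts G) = real (num_triangles G) + 1 / 2 * real (num_edges G)"
    by (simp add: g.weight_def num_triangles_def num_edges_def)
  \<comment> \<open>A colouring with \<open>m\<close> colours would bound the least number of
    colours by \<open>m\<close>, which is r - 1.\<close>
  moreover have "\<not> g.colourable m (pverts G)"
  proof
    assume "g.colourable m (pverts G)"
    then obtain c where "c ` pverts G \<subseteq> {..<m}"
        "\<And>u v. u \<in> pverts G \<Longrightarrow> v \<in> pverts G \<Longrightarrow> (u, v) \<in> parcs G \<Longrightarrow> c u \<noteq> c v"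
      unfolding g.colourable_def by blast
    then have "proper_colouring G m c"
      using wf unfolding proper_colouring_def by blast
    then have "\<exists>c. proper_colouring G m c" by blast
    then have "chromatic_number G \<le> m"
      unfolding chromatic_number_def by (rule Least_le)
    then show False using assms(3) m by simp
  qed
  ultimately show ?thesis
    using g.weight_ge_of_not_colourable[OF pair_finite_verts, of m]
    unfolding m sum_squares_eq_binomial by metis
qed

end
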